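(* For every integer partition $\alpha=1^{a_1}2^{a_2}\cdots$ and every integer $n\ge 0$, $$\left\langle \binom{X}{\alpha}\right\rangle_n=\begin{cases}0 & \text{if } n<|\alpha|,\\ 1/z_\alpha & \text{otherwise.}\end{cases}$$
   Context: Let $K$ be a field of characteristic $0$ and $P=K[X_1,X_2,\dots]$ the polynomial ring in infinitely many variables. For a permutation $w\in S_n$ let $X_i(w)$ be the number of $i$-cycles of $w$. For $q\in P$, the moment of $q$ at $n$ is $\langle q\rangle_n=\frac1{n!}\sum_{w\in S_n}q(X_1(w),X_2(w),\dots)$. An integer partition is written in exponential notation $\alpha=1^{a_1}2^{a_2}\cdots r^{a_r}$, where $a_i$ is the number of parts of size $i$; $|\alpha|=a_1+2a_2+\cdots+ra_r$. Put $\binom{X}{\alpha}=\binom{X_1}{a_1}\binom{X_2}{a_2}\cdots\binom{X_r}{a_r}\in P$, where $\binom{X_i}{a}=X_i(X_i-1)\cdots(X_i-a+1)/a!$, and $z_\alpha=\prod_{i=1}^r i^{a_i}a_i!$. *)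

theory Defs
  imports Complex_Main "HOL-Library.Poly_Mapping" "HOL-Library.Multiset"
    "HOL-Combinatorics.Orbits"
begin

text \<open>
  The polynomial ring \<open>P = K[X\<^sub>1, X\<^sub>2, \<dots>]\<close>, with its ring structure from
  \<open>Poly_Mapping\<close>: a polynomial is a finitely supported map from monomials to coefficients,
  and a monomial is a finitely supported map from variables to exponents. The variables
  \<open>X\<^sub>1, X\<^sub>2, \<dots>\<close> are numbered from 1 while the indices in the type start at 0, so that
  the index \<open>k\<close> stands for \<open>X\<^bsub>k+1\<^esub>\<close>; this gives exactly the variables of \<open>P\<close>
  and no spurious \<open>X\<^sub>0\<close>.
\<close>

type_synonym 'k cycle_poly = "(nat \<Rightarrow>\<^sub>0 nat) \<Rightarrow>\<^sub>0 'k"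

definition Const :: "'k \<Rightarrow> 'k::field_char_0 cycle_poly" where
  "Const c = Poly_Mapping.single 0 c"

text \<open>Only meaningful for \<open>i \<ge> 1\<close>.\<close>

definition X :: "nat \<Rightarrow> 'k::field_char_0 cycle_poly" where
  "X i = Poly_Mapping.single (Poly_Mapping.single (i - 1) 1) 1"

text \<open>Evaluation \<open>q(x 1, x 2, \<dots>)\<close>; the value \<open>x 0\<close> is not used.\<close>

definition eval_poly :: "(nat \<Rightarrow> 'k) \<Rightarrow> 'k::field_char_0 cycle_poly \<Rightarrow> 'k" where
  "eval_poly x q = (\<Sum>m\<in>Poly_Mapping.keys q. Poly_Mapping.lookup q m *
     (\<Prod>k\<in>Poly_Mapping.keys m. x (Suc k) ^ Poly_Mapping.lookup m k))"

text \<open>The cycles of a permutation of \<open>{1..n}\<close> are its orbits; fixed points are 1-cycles.\<close>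

definition num_cycles :: "nat \<Rightarrow> (nat \<Rightarrow> nat) \<Rightarrow> nat \<Rightarrow> nat" where
  "num_cycles n w i = card {C \<in> orbit w ` {1..n}. card C = i}"

definition moment :: "nat \<Rightarrow> 'k::field_char_0 cycle_poly \<Rightarrow> 'k" where
  "moment n q =
     1 / fact n * (\<Sum>w | w permutes {1..n}. eval_poly (\<lambda>i. of_nat (num_cycles n w i)) q)"

text \<open>
  An integer partition is the multiset of its parts. Then \<open>count \<alpha> i\<close> is the exponent \<open>a\<^sub>i\<close>
  in \<open>1\<^bsup>a\<^sub>1\<^esup> 2\<^bsup>a\<^sub>2\<^esup> \<dots>\<close> and \<open>sum_mset \<alpha>\<close> is \<open>|\<alpha>|\<close>. The products below run over
  the \<open>i\<close> with \<open>a\<^sub>i > 0\<close> only, the other factors being 1.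
\<close>

definition is_partition :: "nat multiset \<Rightarrow> bool" where
  "is_partition \<alpha> \<longleftrightarrow> 0 \<notin># \<alpha>"

text \<open>\<open>X\<^sub>i (X\<^sub>i - 1) \<dots> (X\<^sub>i - a + 1) / a!\<close>, as an element of \<open>P\<close>\<close>

definition binom_var :: "nat \<Rightarrow> nat \<Rightarrow> 'k::field_char_0 cycle_poly" where
  "binom_var i a = Const (1 / fact a) * (\<Prod>j<a. X i - of_nat j)"

definition binom_poly :: "nat multiset \<Rightarrow> 'k::field_char_0 cycle_poly" where
  "binom_poly \<alpha> = (\<Prod>i\<in>set_mset \<alpha>. binom_var i (count \<alpha> i))"

definition zee :: "nat multiset \<Rightarrow> nat" where
  "zee \<alpha> = (\<Prod>i\<in>set_mset \<alpha>. i ^ count \<alpha> i * fact (count \<alpha> i))"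

end

theory Submission
  imports Defs
begin

text \<open>
  For a permutation \<open>w\<close>, the value of \<open>binom_poly \<alpha>\<close> at its cycle numbers is the number of ways
  to select among the cycles of \<open>w\<close>, for every \<open>i\<close>, exactly \<open>count \<alpha> i\<close> cycles of length \<open>i\<close>.
  So \<open>n!\<close> times the moment counts the permutations of an \<open>n\<close>-set together with such a selection,
  and the claim is that this number \<open>S\<close> satisfies \<open>zee \<alpha> * S = n!\<close> if \<open>\<alpha>\<close> fits into the set,
  and is 0 otherwise (\<open>sum_cycle_selections\<close>).

  The count goes by induction on \<open>\<alpha>\<close>, over all finite sets at once. Given a selection of type
  \<open>\<alpha>\<close> plus one part \<open>i\<close>, mark one of its \<open>i\<close>-cycles, which can be done in \<open>count \<alpha> i + 1\<close> ways.
  Deleting the marked cycle \<open>C\<close> leaves a permutation of the complement of \<open>C\<close> with a selection of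
  type \<open>\<alpha>\<close>, and what is deleted is an arbitrary cyclic permutation of \<open>C\<close>
  (\<open>cycle_selections_add_mset\<close>, \<open>sum_marked_cycles\<close>). There are \<open>n choose i\<close> sets \<open>C\<close>, each with
  \<open>(i - 1)!\<close> cyclic permutations, so by the induction hypothesis
  \[ (a+1) \, S' = {n \choose i} (i-1)! \, \frac{(n-i)!}{z} = \frac{n!}{i \, z} \]
  with \<open>z = zee \<alpha>\<close> and \<open>a = count \<alpha> i\<close>; and \<open>i * (a + 1) * z\<close> is \<open>zee\<close> of the enlarged partition.
  The factor \<open>n choose i\<close> and the induction hypothesis also account for the vanishing.

  That a nonempty finite set has \<open>(k - 1)!\<close> cyclic permutations, \<open>k\<close> its size, comes from the same
  splitting, applied to the cycle through a chosen element (\<open>card_cyclic_perms\<close>).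
  It remains to know that \<open>eval_poly\<close> is a ring homomorphism, so that it turns
  \<open>binom_poly \<alpha>\<close> into a product of binomial coefficients of cycle numbers.
\<close>

section \<open>Splitting off a cycle\<close>

text \<open>
  \<open>num_cycles\<close> over an arbitrary set: deleting a cycle leaves a permutation of a set that is no
  longer an initial segment.
\<close>

definition cycle_count :: "'a set \<Rightarrow> ('a \<Rightarrow> 'a) \<Rightarrow> nat \<Rightarrow> nat" where
  "cycle_count A w i = card {C \<in> orbit w ` A. card C = i}"

definition cyclic_perms :: "'a set \<Rightarrow> ('a \<Rightarrow> 'a) set" where
  "cyclic_perms C = {s. s permutes C \<and> cyclic_on s C}"

lemma mem_orbits_iff_cyclic_on:
  assumes "w permutes A" "finite A" "C \<subseteq> A"
  shows "C \<in> orbit w ` A \<longleftrightarrow> cyclic_on w C"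
proof
  assume "C \<in> orbit w ` A"
  then show "cyclic_on w C" using cyclic_on_orbit[OF assms(1,2)] by auto
next
  assume "cyclic_on w C"
  then obtain s where "s \<in> C" "C = orbit w s" by (auto simp: cyclic_on_def)
  then show "C \<in> orbit w ` A" using assms(3) by auto
qed

text \<open>
  A cycle is mapped into itself, and an injective map of a finite set into itself is onto.
\<close>

lemma perm_restrict_cyclic_permutes:
  assumes "w permutes A" "cyclic_on w C"
  shows "perm_restrict w C permutes C"
proof -
  have fin: "finite C" using assms(2) by (rule finite_cyclic_on)
  have inj: "inj_on w C" using assms(1) by (rule permutes_inj_on)
  have "w ` C \<subseteq> C" using cyclic_on_inI[OF assms(2)] by auto
  then have "bij_betw w C C"
    using fin inj by (simp add: bij_betw_def endo_inj_surj)
  then have "bij_betw (perm_restrict w C) C C"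
    by (subst bij_betw_cong[of _ _ w]) (auto simp: perm_restrict_def)
  then show ?thesis
    by (rule bij_imp_permutes) (simp add: perm_restrict_def)
qed

text \<open>
  A permutation with cycle \<open>C\<close> is the composition of its restrictions to \<open>C\<close> and to the
  complement. The first is any cyclic permutation of \<open>C\<close>, the second any permutation of the
  complement, and the two are independent of each other.
\<close>

lemma sum_perms_with_cycle:
  fixes f :: "('a \<Rightarrow> 'a) \<Rightarrow> 'b::comm_semiring_1"
  assumes A: "finite A" and C: "C \<subseteq> A"
  shows "(\<Sum>w | w permutes A \<and> cyclic_on w C. f (perm_restrict w (A - C)))
    = of_nat (card (cyclic_perms C)) * (\<Sum>v | v permutes (A - C). f v)"
proof -
  have comp: "perm_restrict (s \<circ> v) C = s" "perm_restrict (s \<circ> v) (A - C) = v"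
    if s: "s permutes C" and v: "v permutes (A - C)" for s v
  proof -
    show "perm_restrict (s \<circ> v) C = s"
      using permutes_not_in[OF s] permutes_not_in[OF v]
      by (auto simp: perm_restrict_def fun_eq_iff)
    show "perm_restrict (s \<circ> v) (A - C) = v"
      using permutes_not_in[OF s] permutes_not_in[OF v] permutes_in_image[OF v]
      by (auto simp: perm_restrict_def fun_eq_iff)
  qed
  have "(\<Sum>w | w permutes A \<and> cyclic_on w C. f (perm_restrict w (A - C)))
    = (\<Sum>(s, v) \<in> cyclic_perms C \<times> {v. v permutes (A - C)}. f v)"
  proof (rule sum.reindex_bij_witness[where
        i = "\<lambda>(s, v). s \<circ> v" and j = "\<lambda>w. (perm_restrict w C, perm_restrict w (A - C))"])
    fix w assume "w \<in> {w. w permutes A \<and> cyclic_on w C}"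
    then have w: "w permutes A" "cyclic_on w C" by auto
    have p1: "perm_restrict w C permutes C"
      by (rule perm_restrict_cyclic_permutes[OF w])
    have p2: "perm_restrict w (A - C) permutes (A - C)"
      by (rule perm_restrict_diff_cyclic[OF w])
    have "perm_restrict w C \<circ> perm_restrict w (A - C) = perm_restrict w (C \<union> (A - C))"
      using p1 p2 by (rule perm_restrict_union) auto
    also have "C \<union> (A - C) = A" using C by auto
    also have "perm_restrict w A = w" using w(1) by (rule perm_restrict_id)
    finally show "(case (perm_restrict w C, perm_restrict w (A - C)) of (s, v) \<Rightarrow> s \<circ> v) = w"
      by (simp only: prod.case)
    show "(perm_restrict w C, perm_restrict w (A - C)) \<in> cyclic_perms C \<times> {v. v permutes (A - C)}"
      using p1 p2 w(2) by (simp add: cyclic_perms_def cyclic_on_perm_restrict)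
  next
    fix p assume "p \<in> cyclic_perms C \<times> {v. v permutes (A - C)}"
    then obtain s v where p: "p = (s, v)"
      and s: "s permutes C" and cyc: "cyclic_on s C" and v: "v permutes (A - C)"
      by (auto simp: cyclic_perms_def)
    show "(perm_restrict (case p of (s, v) \<Rightarrow> s \<circ> v) C,
        perm_restrict (case p of (s, v) \<Rightarrow> s \<circ> v) (A - C)) = p"
      using comp[OF s v] p by simp
    have "s \<circ> v permutes A"
      using permutes_subset[OF s C] permutes_subset[OF v] by (intro permutes_compose) auto
    moreover have "cyclic_on (s \<circ> v) C"
      by (rule permutes_comp_preserves_cyclic1[OF v cyc, of C]) auto
    ultimately show "(case p of (s, v) \<Rightarrow> s \<circ> v) \<in> {w. w permutes A \<and> cyclic_on w C}"
      using p by simp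
  qed auto
  also have "\<dots> = of_nat (card (cyclic_perms C)) * (\<Sum>v | v permutes (A - C). f v)"
    by (simp add: sum.cartesian_product[symmetric])
  finally show ?thesis .
qed

section \<open>The number of cyclic permutations\<close>

lemma sum_Pow_card:
  fixes f :: "nat \<Rightarrow> nat"
  assumes "finite B"
  shows "(\<Sum>E\<in>Pow B. f (card E)) = (\<Sum>k\<le>card B. (card B choose k) * f k)"
proof -
  have "(\<Sum>E\<in>Pow B. f (card E)) = (\<Sum>k\<le>card B. \<Sum>E | E \<in> Pow B \<and> card E = k. f (card E))"
    using assms by (intro sum.group[symmetric]) (auto intro: card_mono)
  also have "\<dots> = (\<Sum>k\<le>card B. (card B choose k) * f k)"
    using n_subsets[OF assms] by (intro sum.cong) (auto simp: Pow_def)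
  finally show ?thesis .
qed

text \<open>
  After removing \<open>x\<close> from every \<open>D\<close>, this is a sum over the subsets \<open>E\<close> of a set of size \<open>m = card C - 1\<close>.
  There are \<open>m choose k\<close> sets \<open>E\<close> of size \<open>k\<close>, each contributing \<open>k! (m - k)!\<close>, hence \<open>m!\<close> for
  each of the \<open>m + 1\<close> sizes. The identity is what \<open>card_cyclic_perms\<close> predicts when permutations
  of \<open>C\<close> are sorted by the cycle of \<open>x\<close>.
\<close>

lemma sum_fact_pointed_subsets:
  assumes "finite C" "x \<in> C"
  shows "(\<Sum>D | D \<subseteq> C \<and> x \<in> D. fact (card D - 1) * fact (card C - card D)) = (fact (card C) :: nat)"
proof -
  define B where "B = C - {x}"
  have B: "finite B" "x \<notin> B" "C = insert x B" using assms by (auto simp: B_def)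
  have "(\<Sum>D | D \<subseteq> C \<and> x \<in> D. fact (card D - 1) * fact (card C - card D))
      = (\<Sum>E\<in>Pow B. fact (card E) * fact (card B - card E) :: nat)"
  proof (rule sum.reindex_bij_witness[where i = "insert x" and j = "\<lambda>D. D - {x}"])
    fix D assume D: "D \<in> {D. D \<subseteq> C \<and> x \<in> D}"
    then have "finite D" using assms finite_subset by auto
    then show "fact (card (D - {x})) * fact (card B - card (D - {x}))
        = (fact (card D - 1) * fact (card C - card D) :: nat)"
      using D B by (cases "card D") (auto simp: card_Diff_singleton)
  qed (use B in auto)
  also have "\<dots> = (\<Sum>k\<le>card B. (card B choose k) * (fact k * fact (card B - k)))"
    by (rule sum_Pow_card[OF B(1)])
  also have "\<dots> = (\<Sum>k\<le>card B. fact (card B))"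
    by (intro sum.cong) (auto simp: binomial_fact_lemma[symmetric] mult_ac)
  also have "\<dots> = fact (card C)" using B by simp
  finally show ?thesis .
qed

text \<open>
  Sorting the permutations of \<open>C\<close> by the cycle \<open>D\<close> of a chosen element \<open>x\<close> writes \<open>(card C)!\<close> as the
  sum of \<open>card (cyclic_perms D) * (card C - card D)!\<close>. This is a recursion that determines the
  numbers of cyclic permutations, and by \<open>sum_fact_pointed_subsets\<close> the numbers
  \<open>(card D - 1)!\<close> satisfy the same one: by induction all terms with \<open>D \<noteq> C\<close> agree, so those with
  \<open>D = C\<close> do as well.
\<close>

lemma card_cyclic_perms:
  assumes "finite C" "C \<noteq> {}"
  shows "card (cyclic_perms C) = fact (card C - 1)"
  using assms
proof (induction C rule: finite_psubset_induct)
  case (psubset C)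
  then obtain x where x: "x \<in> C" by auto
  define \<D> where "\<D> = {D. D \<subseteq> C \<and> x \<in> D}"
  have fin: "finite \<D>" and C: "C \<in> \<D>" using psubset.hyps x by (auto simp: \<D>_def)
  have "fact (card C) = (\<Sum>w | w permutes C. 1)"
    using card_permutations[OF refl psubset.hyps] by simp
  also have "\<dots> = (\<Sum>D\<in>\<D>. \<Sum>w | w \<in> {w. w permutes C} \<and> orbit w x = D. 1)"
  proof (rule sum.group[symmetric])
    show "finite {w. w permutes C}" by (rule finite_permutations[OF psubset.hyps])
    show "(\<lambda>w. orbit w x) ` {w. w permutes C} \<subseteq> \<D>"
      using permutes_orbit_subset x psubset.hyps
      by (fastforce simp: \<D>_def intro: permutation_self_in_orbit permutes_imp_permutation)
  qed (rule fin)
  also have "\<dots> = (\<Sum>D\<in>\<D>. card (cyclic_perms D) * fact (card C - card D))"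
  proof (rule sum.cong[OF refl])
    fix D assume "D \<in> \<D>"
    then have D: "D \<subseteq> C" "x \<in> D" by (auto simp: \<D>_def)
    have "orbit w x = D \<longleftrightarrow> cyclic_on w D" if "w permutes C" for w
      using cyclic_on_orbit[OF that psubset.hyps] orbit_cyclic_eq3 D(2) by metis
    then have "{w. w permutes C \<and> orbit w x = D} = {w. w permutes C \<and> cyclic_on w D}"
      by auto
    then have "(\<Sum>w | w \<in> {w. w permutes C} \<and> orbit w x = D. 1)
        = (\<Sum>w | w permutes C \<and> cyclic_on w D. 1)" by simp
    also have "\<dots> = card (cyclic_perms D) * (\<Sum>v | v permutes (C - D). 1)"
      using sum_perms_with_cycle[OF psubset.hyps D(1), of "\<lambda>_. 1::nat"] by simp
    also have "(\<Sum>v | v permutes (C - D). 1) = fact (card C - card D)"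
      using card_permutations[of "C - D"] psubset.hyps D(1)
      by (simp add: card_Diff_subset finite_subset)
    finally show "(\<Sum>w | w \<in> {w. w permutes C} \<and> orbit w x = D. 1)
        = card (cyclic_perms D) * fact (card C - card D)" .
  qed
  also have "\<dots> = card (cyclic_perms C)
      + (\<Sum>D\<in>\<D> - {C}. card (cyclic_perms D) * fact (card C - card D))"
    by (simp add: sum.remove[OF fin C])
  also have "(\<Sum>D\<in>\<D> - {C}. card (cyclic_perms D) * fact (card C - card D))
      = (\<Sum>D\<in>\<D> - {C}. fact (card D - 1) * fact (card C - card D))"
  proof (rule sum.cong[OF refl])
    fix D assume "D \<in> \<D> - {C}"
    then have "D \<subset> C" "D \<noteq> {}" by (auto simp: \<D>_def)
    then show "card (cyclic_perms D) * fact (card C - card D)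
        = fact (card D - 1) * fact (card C - card D)"
      using psubset.IH by simp
  qed
  finally have "fact (card C) = card (cyclic_perms C)
      + (\<Sum>D\<in>\<D> - {C}. fact (card D - 1) * fact (card C - card D))" .
  moreover have "fact (card C) = fact (card C - 1)
      + (\<Sum>D\<in>\<D> - {C}. fact (card D - 1) * fact (card C - card D) :: nat)"
    using sum_fact_pointed_subsets[OF psubset.hyps x]
      sum.remove[OF fin C, of "\<lambda>D. fact (card D - 1) * fact (card C - card D) :: nat"]
    by (simp add: \<D>_def)
  ultimately show ?case by linarith
qed

section \<open>Counting selections of cycles\<close>

text \<open>
  Exchanging the sums, first choose the set \<open>C\<close>, then a permutation that has \<open>C\<close> as a cycle.
  The summand sees only what remains of the permutation after \<open>C\<close> is deleted.
\<close>

lemma sum_marked_cycles: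
  fixes f :: "'a set \<Rightarrow> ('a \<Rightarrow> 'a) \<Rightarrow> nat"
  assumes A: "finite A" and i: "i \<ge> 1"
  shows "(\<Sum>w | w permutes A. \<Sum>C | C \<in> orbit w ` A \<and> card C = i. f C (perm_restrict w (A - C)))
    = fact (i - 1) * (\<Sum>C | C \<subseteq> A \<and> card C = i. \<Sum>v | v permutes (A - C). f C v)"
proof -
  define \<C> where "\<C> = {C. C \<subseteq> A \<and> card C = i}"
  have fin: "finite \<C>" using A by (simp add: \<C>_def)
  have "(\<Sum>w | w permutes A. \<Sum>C | C \<in> orbit w ` A \<and> card C = i. f C (perm_restrict w (A - C)))
    = (\<Sum>w | w permutes A. \<Sum>C | C \<in> \<C> \<and> cyclic_on w C. f C (perm_restrict w (A - C)))"
  proof (rule sum.cong[OF refl])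
    fix w assume "w \<in> {w. w permutes A}"
    then have w: "w permutes A" by simp
    have "{C. C \<in> orbit w ` A \<and> card C = i} = {C. C \<in> \<C> \<and> cyclic_on w C}"
      using mem_orbits_iff_cyclic_on[OF w A] permutes_orbit_subset[OF w]
      unfolding \<C>_def by blast
    then show "(\<Sum>C | C \<in> orbit w ` A \<and> card C = i. f C (perm_restrict w (A - C)))
        = (\<Sum>C | C \<in> \<C> \<and> cyclic_on w C. f C (perm_restrict w (A - C)))" by simp
  qed
  also have "\<dots> = (\<Sum>C\<in>\<C>. \<Sum>w | w permutes A \<and> cyclic_on w C. f C (perm_restrict w (A - C)))"
    using sum.swap_restrict[OF finite_permutations[OF A] fin,
        of "\<lambda>w C. f C (perm_restrict w (A - C))" cyclic_on] by simp
  also have "\<dots> = (\<Sum>C\<in>\<C>. fact (i - 1) * (\<Sum>v | v permutes (A - C). f C v))"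
  proof (rule sum.cong[OF refl])
    fix C assume "C \<in> \<C>"
    then have C: "C \<subseteq> A" "card C = i" "finite C" "C \<noteq> {}"
      using A i by (auto simp: \<C>_def intro: finite_subset)
    show "(\<Sum>w | w permutes A \<and> cyclic_on w C. f C (perm_restrict w (A - C)))
        = fact (i - 1) * (\<Sum>v | v permutes (A - C). f C v)"
      using sum_perms_with_cycle[OF A C(1), of "f C"] card_cyclic_perms[OF C(3,4)] C(2) by simp
  qed
  finally show ?thesis by (simp add: \<C>_def sum_distrib_left)
qed

text \<open>
  Off \<open>C\<close> the permutation is unchanged, so its orbits are \<open>C\<close> and the orbits of the restriction.
\<close>

lemma cycle_count_remove_cycle:
  assumes w: "w permutes A" and A: "finite A" and C: "C \<in> orbit w ` A"
  shows "cycle_count A w j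
    = cycle_count (A - C) (perm_restrict w (A - C)) j + (if card C = j then 1 else 0)"
proof -
  have CA: "C \<subseteq> A" using C permutes_orbit_subset[OF w] by auto
  have cyc: "cyclic_on w C" using mem_orbits_iff_cyclic_on[OF w A CA] C by simp
  let ?v = "perm_restrict w (A - C)"
  have v: "?v permutes (A - C)" by (rule perm_restrict_diff_cyclic[OF w cyc])
  have eq: "orbit w x = orbit ?v x" if "x \<in> A - C" for x
    by (rule sym, rule orbit_cong0[OF that])
      (use permutes_in_image[OF v] in \<open>auto simp: perm_restrict_simps\<close>)
  have "orbit w ` A = orbit w ` C \<union> orbit w ` (A - C)" using CA by auto
  also have "orbit w ` C = {C}"
    using cyc orbit_cyclic_eq3[OF cyc] by (auto simp: cyclic_on_alldef)
  also have "orbit w ` (A - C) = orbit ?v ` (A - C)" using eq by (intro image_cong) auto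
  finally have orbs: "orbit w ` A = insert C (orbit ?v ` (A - C))" by simp
  have "C \<noteq> {}" using cyc by (auto simp: cyclic_on_def)
  then have notin: "C \<notin> orbit ?v ` (A - C)"
    using permutes_orbit_subset[OF v] by fastforce
  have "{D \<in> orbit w ` A. card D = j} = (if card C = j then insert C else id)
      {D \<in> orbit ?v ` (A - C). card D = j}"
    unfolding orbs by auto
  then show ?thesis using notin A by (simp add: cycle_count_def)
qed

text \<open>
  The number of sets of cycles of \<open>w\<close> on \<open>A\<close> whose lengths form the multiset \<open>\<alpha>\<close>.
\<close>

definition cycle_selections :: "'a set \<Rightarrow> ('a \<Rightarrow> 'a) \<Rightarrow> nat multiset \<Rightarrow> nat" where
  "cycle_selections A w \<alpha> = (\<Prod>i\<in>set_mset \<alpha>. cycle_count A w i choose count \<alpha> i)"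

text \<open>
  Both \<open>zee\<close> and \<open>cycle_selections\<close> are products over the distinct parts of \<open>\<alpha>\<close>. The next two
  lemmas isolate the factor of one part \<open>i\<close>, whether or not it occurs in \<open>\<alpha>\<close>.
\<close>

lemma prod_set_mset_add_mset:
  fixes f :: "'a \<Rightarrow> nat \<Rightarrow> 'b::comm_monoid_mult"
  shows "(\<Prod>j\<in>set_mset (add_mset i \<alpha>). f j (count (add_mset i \<alpha>) j))
      = f i (Suc (count \<alpha> i)) * (\<Prod>j\<in>set_mset \<alpha> - {i}. f j (count \<alpha> j))"
proof -
  have "(\<Prod>j\<in>set_mset \<alpha> - {i}. f j (count (add_mset i \<alpha>) j))
      = (\<Prod>j\<in>set_mset \<alpha> - {i}. f j (count \<alpha> j))"
    by (rule prod.cong) auto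
  then show ?thesis by (simp add: prod.insert_remove del: count_add_mset) simp
qed

lemma prod_set_mset_remove:
  fixes f :: "'a \<Rightarrow> nat \<Rightarrow> 'b::comm_monoid_mult"
  assumes "\<And>j. f j 0 = 1"
  shows "(\<Prod>j\<in>set_mset \<alpha>. f j (count \<alpha> j))
      = f i (count \<alpha> i) * (\<Prod>j\<in>set_mset \<alpha> - {i}. f j (count \<alpha> j))"
  using assms by (cases "i \<in># \<alpha>") (auto simp: prod.remove not_in_iff)

text \<open>
  Both sides count selections of type \<open>add_mset i \<alpha>\<close> with one \<open>i\<close>-cycle marked: on the left the
  mark is chosen last, on the right first. With \<open>N\<close> the number of \<open>i\<close>-cycles and \<open>a = count \<alpha> i\<close>,
  this is the absorption identity \<open>(a + 1) * (N choose (a + 1)) = N * ((N - 1) choose a)\<close>,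
  as the cycles of other lengths are not affected.
\<close>

lemma cycle_selections_add_mset:
  assumes w: "w permutes A" and A: "finite A"
  shows "Suc (count \<alpha> i) * cycle_selections A w (add_mset i \<alpha>)
    = (\<Sum>C | C \<in> orbit w ` A \<and> card C = i.
        cycle_selections (A - C) (perm_restrict w (A - C)) \<alpha>)"
proof -
  define N where "N = cycle_count A w i"
  define R where "R = (\<Prod>j\<in>set_mset \<alpha> - {i}. cycle_count A w j choose count \<alpha> j)"
  have "cycle_selections (A - C) (perm_restrict w (A - C)) \<alpha> = ((N - 1) choose count \<alpha> i) * R"
    if "C \<in> orbit w ` A" "card C = i" for C
  proof -
    have "cycle_count (A - C) (perm_restrict w (A - C)) j = cycle_count A w j - (if j = i then 1 else 0)" for j
      using cycle_count_remove_cycle[OF w A that(1), of j] that(2) by auto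
    then show ?thesis
      unfolding cycle_selections_def N_def R_def
      by (subst prod_set_mset_remove[where i = i]) auto
  qed
  then have "(\<Sum>C | C \<in> orbit w ` A \<and> card C = i.
        cycle_selections (A - C) (perm_restrict w (A - C)) \<alpha>) = N * (((N - 1) choose count \<alpha> i) * R)"
    by (simp add: N_def cycle_count_def)
  also have "\<dots> = Suc (count \<alpha> i) * ((N choose Suc (count \<alpha> i)) * R)"
    by (cases N) (use Suc_times_binomial in \<open>auto simp: mult.assoc[symmetric]\<close>)
  also have "(N choose Suc (count \<alpha> i)) * R = cycle_selections A w (add_mset i \<alpha>)"
    unfolding cycle_selections_def N_def R_def
    by (subst prod_set_mset_add_mset) auto
  finally show ?thesis by simp
qed

lemma zee_add_mset: "zee (add_mset i \<alpha>) = i * Suc (count \<alpha> i) * zee \<alpha>"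
  unfolding zee_def
  by (subst prod_set_mset_add_mset, simp, subst prod_set_mset_remove[where i = i], simp)
    (simp add: algebra_simps)

lemma sum_cycle_selections:
  assumes "finite A" "is_partition \<alpha>"
  shows "zee \<alpha> * (\<Sum>w | w permutes A. cycle_selections A w \<alpha>)
    = (if card A < sum_mset \<alpha> then 0 else fact (card A))"
  using assms
proof (induction \<alpha> arbitrary: A)
  case empty
  then show ?case
    using card_permutations[of A] by (simp add: zee_def cycle_selections_def)
next
  case (add i \<alpha>)
  have i: "i \<ge> 1" and \<alpha>: "is_partition \<alpha>"
    using add.prems by (auto simp: is_partition_def Suc_le_eq)
  let ?n = "card A"
  let ?T = "if ?n - i < sum_mset \<alpha> then 0 else fact (?n - i) :: nat"
  have "zee (add_mset i \<alpha>) * (\<Sum>w | w permutes A. cycle_selections A w (add_mset i \<alpha>))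
      = i * zee \<alpha> * (\<Sum>w | w permutes A. Suc (count \<alpha> i) * cycle_selections A w (add_mset i \<alpha>))"
    by (simp only: zee_add_mset sum_distrib_left mult_ac)
  also have "\<dots> = i * zee \<alpha> * (\<Sum>w | w permutes A. \<Sum>C | C \<in> orbit w ` A \<and> card C = i.
        cycle_selections (A - C) (perm_restrict w (A - C)) \<alpha>)"
    using cycle_selections_add_mset[OF _ add.prems(1)] by simp
  also have "\<dots> = (i * fact (i - 1)) * (\<Sum>C | C \<subseteq> A \<and> card C = i.
        zee \<alpha> * (\<Sum>v | v permutes (A - C). cycle_selections (A - C) v \<alpha>))"
    by (subst sum_marked_cycles[OF add.prems(1) i]) (simp add: sum_distrib_left mult_ac)
  also have "i * fact (i - 1) = (fact i :: nat)" using i by (simp add: fact_reduce)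
  also have "(\<Sum>C | C \<subseteq> A \<and> card C = i.
        zee \<alpha> * (\<Sum>v | v permutes (A - C). cycle_selections (A - C) v \<alpha>))
      = (\<Sum>C | C \<subseteq> A \<and> card C = i. ?T)"
    using add.IH[OF _ \<alpha>] add.prems(1)
    by (intro sum.cong) (auto simp: card_Diff_subset finite_subset)
  also have "\<dots> = (?n choose i) * ?T"
    using n_subsets[OF add.prems(1)] by simp
  also have "fact i * ((?n choose i) * ?T) = (if ?n < sum_mset (add_mset i \<alpha>) then 0 else fact ?n)"
    using binomial_fact_lemma[of i ?n] by (cases "i \<le> ?n") (auto simp: mult_ac binomial_eq_0)
  finally show ?case .
qed

section \<open>Evaluation of polynomials\<close>

definition eval_mono :: "(nat \<Rightarrow> 'k) \<Rightarrow> (nat \<Rightarrow>\<^sub>0 nat) \<Rightarrow> 'k::field_char_0" where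
  "eval_mono x m = (\<Prod>k\<in>Poly_Mapping.keys m. x (Suc k) ^ Poly_Mapping.lookup m k)"

text \<open>
  The support of a sum differs from those of its summands, so additivity is proved over a common
  finite superset of the supports.
\<close>

lemma eval_mono_superset:
  assumes "finite S" "Poly_Mapping.keys m \<subseteq> S"
  shows "eval_mono x m = (\<Prod>k\<in>S. x (Suc k) ^ Poly_Mapping.lookup m k)"
  unfolding eval_mono_def using assms
  by (intro prod.mono_neutral_left) (auto simp: in_keys_iff)

lemma eval_mono_add: "eval_mono x (m + m') = eval_mono x m * eval_mono x m'"
proof -
  let ?S = "Poly_Mapping.keys m \<union> Poly_Mapping.keys m'"
  have "Poly_Mapping.keys (m + m') \<subseteq> ?S" by (rule Poly_Mapping.keys_add)
  then show ?thesis
    by (subst (1 2 3) eval_mono_superset[of ?S])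
      (auto simp: Poly_Mapping.lookup_add power_add prod.distrib)
qed

lemma eval_poly_superset:
  assumes "finite S" "Poly_Mapping.keys q \<subseteq> S"
  shows "eval_poly x q = (\<Sum>m\<in>S. Poly_Mapping.lookup q m * eval_mono x m)"
  unfolding eval_poly_def eval_mono_def[symmetric] using assms
  by (intro sum.mono_neutral_left) (auto simp: in_keys_iff)

lemma eval_poly_add: "eval_poly x (p + q) = eval_poly x p + eval_poly x q"
proof -
  let ?S = "Poly_Mapping.keys p \<union> Poly_Mapping.keys q"
  have "Poly_Mapping.keys (p + q) \<subseteq> ?S" by (rule Poly_Mapping.keys_add)
  then show ?thesis
    by (subst (1 2 3) eval_poly_superset[of ?S])
      (auto simp: Poly_Mapping.lookup_add algebra_simps sum.distrib)
qed

lemma eval_poly_single: "eval_poly x (Poly_Mapping.single m c) = c * eval_mono x m"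
  by (subst eval_poly_superset[of "{m}"]) auto

lemma eval_poly_0: "eval_poly x 0 = 0"
  by (simp add: eval_poly_def)

lemma eval_poly_1: "eval_poly x 1 = 1"
  using eval_poly_single[of x 0 1] by (simp add: eval_mono_def)

lemma eval_poly_diff: "eval_poly x (p - q) = eval_poly x p - eval_poly x q"
  using eval_poly_add[of x "p - q" q] by simp

lemma cycle_poly_induct [case_names zero add]:
  fixes q :: "'k::field_char_0 cycle_poly"
  assumes "P 0" "\<And>m c q. P q \<Longrightarrow> P (Poly_Mapping.single m c + q)"
  shows "P q"
proof (induction q rule: update_induct)
  case const
  show ?case by (rule assms(1))
next
  case (update q m c)
  have "Poly_Mapping.update m c q = Poly_Mapping.single m c + q"
    using update.hyps
    by (intro poly_mapping_eqI) (auto simp: lookup_update lookup_add lookup_single when_def in_keys_iff)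
  then show ?case using assms(2)[OF update.IH] by simp
qed

lemma eval_poly_mult: "eval_poly x (p * q) = eval_poly x p * eval_poly x q"
proof -
  have mono: "eval_poly x (Poly_Mapping.single m c * q) = eval_poly x (Poly_Mapping.single m c) * eval_poly x q"
    for m c
    by (induction q rule: cycle_poly_induct)
      (simp_all add: eval_poly_0 eval_poly_add distrib_left mult_single eval_poly_single eval_mono_add)
  show ?thesis
    by (induction p rule: cycle_poly_induct)
      (simp_all add: eval_poly_0 eval_poly_add distrib_right mono)
qed

lemma eval_poly_prod: "eval_poly x (\<Prod>i\<in>I. f i) = (\<Prod>i\<in>I. eval_poly x (f i))"
  by (induction I rule: infinite_finite_induct) (simp_all add: eval_poly_1 eval_poly_mult)

lemma eval_poly_of_nat: "eval_poly x (of_nat j) = of_nat j"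
  by (induction j) (simp_all add: eval_poly_0 eval_poly_1 eval_poly_add)

lemma eval_poly_Const: "eval_poly x (Const c) = c"
  by (simp add: Const_def eval_poly_single eval_mono_def)

text \<open>
  The variable \<open>X i\<close> has index \<open>i - 1\<close>, and evaluation shifts back by \<open>Suc\<close>; with truncated
  subtraction, \<open>X 0\<close> would be evaluated like \<open>X 1\<close>.
\<close>

lemma eval_poly_X: "i \<ge> 1 \<Longrightarrow> eval_poly x (X i) = x i"
  by (simp add: X_def eval_poly_single eval_mono_def)

lemma eval_poly_binom_var: "i \<ge> 1 \<Longrightarrow> eval_poly x (binom_var i a) = x i gchoose a"
  by (simp add: binom_var_def eval_poly_mult eval_poly_Const eval_poly_prod eval_poly_diff
      eval_poly_X eval_poly_of_nat gbinomial_prod_rev atLeast0LessThan)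

lemma eval_poly_binom_poly:
  assumes "is_partition \<alpha>"
  shows "eval_poly (\<lambda>i. of_nat (num_cycles n w i)) (binom_poly \<alpha>)
    = of_nat (cycle_selections {1..n} w \<alpha>)"
proof -
  have "eval_poly (\<lambda>i. of_nat (num_cycles n w i)) (binom_var i a)
      = of_nat (cycle_count {1..n} w i choose a)" if "i \<in># \<alpha>" for i a
    using that assms
    by (subst eval_poly_binom_var)
      (auto simp: is_partition_def num_cycles_def cycle_count_def binomial_gbinomial Suc_le_eq
        intro: gr0I)
  then show ?thesis
    unfolding binom_poly_def eval_poly_prod cycle_selections_def of_nat_prod
    by (intro prod.cong refl)
qed

lemma zee_pos: "is_partition \<alpha> \<Longrightarrow> zee \<alpha> > 0"
  unfolding zee_def is_partition_def by (rule prod_pos) (auto intro: gr0I)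

section \<open>The moments\<close>

theorem theorem2p3:
  fixes \<alpha> :: "nat multiset" and n :: nat
  assumes "is_partition \<alpha>"
  shows "moment n (binom_poly \<alpha> :: 'k::field_char_0 cycle_poly) =
    (if n < sum_mset \<alpha> then 0 else 1 / of_nat (zee \<alpha>))"
proof -
  define S where "S = (\<Sum>w | w permutes {1..n}. cycle_selections {1..n} w \<alpha>)"
  have "zee \<alpha> * S = (if n < sum_mset \<alpha> then 0 else fact n)"
    using sum_cycle_selections[of "{1..n}" \<alpha>] assms by (simp add: S_def)
  then have "(of_nat (zee \<alpha> * S) :: 'k) = of_nat (if n < sum_mset \<alpha> then 0 else fact n)"
    by (rule arg_cong)
  then have "(of_nat (zee \<alpha>) * of_nat S :: 'k) = (if n < sum_mset \<alpha> then 0 else fact n)"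
    by (simp split: if_splits)
  moreover have "(of_nat (zee \<alpha>) :: 'k) \<noteq> 0" using zee_pos[OF assms] by simp
  ultimately have "(of_nat S :: 'k) = (if n < sum_mset \<alpha> then 0 else fact n / of_nat (zee \<alpha>))"
    by (auto simp: field_simps split: if_splits)
  moreover have "moment n (binom_poly \<alpha> :: 'k cycle_poly) = 1 / fact n * of_nat S"
    by (simp add: moment_def eval_poly_binom_poly[OF assms] S_def)
  ultimately show ?thesis by simp
qed

end
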